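(* Let $G$ be a compact Hausdorff abelian group with Haar probability measure $\mu$, let $\alpha$ be a real number, and let $A,B$ be $K$-analytic subsets of $G$ satisfying $0<\mu(A+B)\leq \alpha\,\mu(A)$. Then for all non-negative integers $m,n$ we have $\mu(mB-nB)\leq \alpha^{m+n}\mu(A)$.
   Context: A subset $S$ of a topological space $Y$ is a $K_{\sigma\delta}$ set if $S=\bigcap_{i\in\mathbb{N}}\bigcup_{j\in\mathbb{N}}K_{i,j}$ for compact sets $K_{i,j}\subset Y$. A subset $A$ of a Hausdorff space $X$ is $K$-analytic if there is a $K_{\sigma\delta}$ set $S$ in some compact Hausdorff space and a continuous map $f:S\to X$ with $A=f(S)$. ($K$-analytic subsets of $G$ are Haar measurable.) For $m,n\ge 0$, $mB-nB=\{b_1+\dots+b_m-b_1'-\dots-b_n': b_i,b_j'\in B\}$, with the convention that an empty sum is $0$. *)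

theory Defs
  imports "HOL-Analysis.Analysis"
begin

definition K_sigma_delta_in :: "'b topology \<Rightarrow> 'b set \<Rightarrow> bool" where
  "K_sigma_delta_in Y S \<longleftrightarrow>
     (\<exists>K :: nat \<Rightarrow> nat \<Rightarrow> 'b set. (\<forall>i j. compactin Y (K i j)) \<and>
        S = (\<Inter>i. \<Union>j. K i j))"

text \<open>A is K-analytic, witnessed by a compact Hausdorff space whose points live
  in the type 'b (the type is universally quantified in theorems, which amounts
  to an existential over the witnessing space in the hypothesis).\<close>
definition K_analytic_via :: "'b itself \<Rightarrow> 'a::topological_space set \<Rightarrow> bool" where
  "K_analytic_via _ A \<longleftrightarrow>
     (\<exists>(Y :: 'b topology) S f. compact_space Y \<and> Hausdorff_space Y \<and>
        K_sigma_delta_in Y S \<and> continuous_map (subtopology Y S) euclidean f \<and>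
        f ` S = A)"

definition haar_prob :: "'a::topological_ab_group_add measure \<Rightarrow> bool" where
  "haar_prob M \<longleftrightarrow>
     sets M = sets borel \<and> emeasure M (space M) = 1 \<and>
     (\<forall>x. \<forall>E\<in>sets M. emeasure M ((\<lambda>y. x + y) ` E) = emeasure M E) \<and>
     (\<forall>E\<in>sets M. emeasure M E = (INF U\<in>{U. open U \<and> E \<subseteq> U}. emeasure M U)) \<and>
     (\<forall>E\<in>sets M. emeasure M E = (SUP K\<in>{K. compact K \<and> K \<subseteq> E}. emeasure M K))"

definition sumset :: "'a::ab_group_add set \<Rightarrow> 'a set \<Rightarrow> 'a set" where
  "sumset A B = {a + b | a b. a \<in> A \<and> b \<in> B}"

fun iter_sumset :: "nat \<Rightarrow> 'a::ab_group_add set \<Rightarrow> 'a set" where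
  "iter_sumset 0 B = {0}"
| "iter_sumset (Suc k) B = sumset B (iter_sumset k B)"

definition diff_sumset :: "nat \<Rightarrow> nat \<Rightarrow> 'a::ab_group_add set \<Rightarrow> 'a set" where
  "diff_sumset m n B = {x - y | x y. x \<in> iter_sumset m B \<and> y \<in> iter_sumset n B}"

end

theory Submission
  imports Defs
begin

text \<open>The measures of \<open>A\<close> and \<open>A + B\<close> are positive, hence both sets are measurable (a set that is
  not measurable has measure 0), and \<open>A\<close> can be replaced by a compact subset at the cost of
  enlarging \<open>\<alpha>\<close> slightly. Choquet's capacitability argument for \<open>X \<mapsto> \<mu>\<^sup>* (mX - nX)\<close> replaces \<open>B\<close> by
  a compact subset. For compact sets, Petridis' argument with an almost minimiser \<open>X\<close> of the
  growth ratio gives \<open>\<mu> (X + jB) \<le> \<alpha>\<^sup>j \<mu> X\<close>, and Ruzsa's triangle inequality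
  \<open>\<mu> X \<mu> (mB - nB) \<le> \<mu> (X + mB) \<mu> (X + nB)\<close> concludes.\<close>

section \<open>Algebra of iterated sumsets\<close>

lemma sumset_eq_plus: "sumset A B = A + B"
  by (auto simp: sumset_def set_plus_def)

lemma diff_sumset_eq_plus: "diff_sumset m n B = iter_sumset m B + uminus ` iter_sumset n B"
  by (force simp: diff_sumset_def set_plus_def)

lemma iter_sumset_mono: "A \<subseteq> B \<Longrightarrow> iter_sumset k A \<subseteq> iter_sumset k B"
  by (induction k) (simp_all add: sumset_eq_plus set_plus_mono2)

lemma diff_sumset_mono: "A \<subseteq> B \<Longrightarrow> diff_sumset m n A \<subseteq> diff_sumset m n B"
  unfolding diff_sumset_eq_plus
  by (intro set_plus_mono2 image_mono iter_sumset_mono)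

lemma iter_sumset_add: "iter_sumset (j + k) B = iter_sumset j B + iter_sumset k B"
  by (induction j) (simp_all add: sumset_eq_plus add.assoc)

lemma iter_sumset_plus: "iter_sumset k (A + B) = iter_sumset k A + iter_sumset k B"
  by (induction k) (simp_all add: sumset_eq_plus ac_simps)

lemma zero_in_iter_sumset: "0 \<in> B \<Longrightarrow> 0 \<in> iter_sumset k B"
  by (induction k) (auto simp: sumset_def intro!: exI[of _ 0])

lemma iter_sumset_le_mono:
  assumes "0 \<in> B" "j \<le> k"
  shows "iter_sumset j B \<subseteq> iter_sumset k B"
proof
  fix x assume "x \<in> iter_sumset j B"
  then have "x + 0 \<in> iter_sumset j B + iter_sumset (k - j) B"
    using assms(1) by (intro set_plus_intro zero_in_iter_sumset)
  then show "x \<in> iter_sumset k B"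
    using assms(2) by (simp flip: iter_sumset_add)
qed

lemma iter_sumset_nonempty: "B \<noteq> {} \<Longrightarrow> iter_sumset k B \<noteq> {}"
  by (induction k) (auto simp: sumset_def)

lemma finite_iter_sumset: "finite B \<Longrightarrow> finite (iter_sumset k B)"
  by (induction k) (auto simp: sumset_eq_plus finite_set_plus)

lemma uminus_set_plus: "uminus ` (A + B) = uminus ` A + uminus ` (B :: 'a::ab_group_add set)"
proof (intro equalityI subsetI)
  fix x assume "x \<in> uminus ` (A + B)"
  then obtain a b where "a \<in> A" "b \<in> B" "x = - a + - b"
    by (auto elim!: set_plus_elim)
  then show "x \<in> uminus ` A + uminus ` B"
    by (simp only:) (intro set_plus_intro imageI)
next
  fix x assume "x \<in> uminus ` A + uminus ` B"
  then obtain a b where "a \<in> A" "b \<in> B" "x = - a + - b"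
    by (auto elim!: set_plus_elim)
  then show "x \<in> uminus ` (A + B)"
    by (intro image_eqI[of _ _ "a + b"]) auto
qed

lemma uminus_iter_sumset: "uminus ` iter_sumset k B = iter_sumset k (uminus ` B)"
  by (induction k) (simp_all add: sumset_eq_plus uminus_set_plus)

lemma diff_sumset_plus:
  "diff_sumset m n (A + B) = diff_sumset m n A + diff_sumset m n B"
  by (simp add: diff_sumset_eq_plus iter_sumset_plus uminus_set_plus ac_simps)

text \<open>Two indices can be raised to a common one. Carried over to \<open>diff_sumset\<close>,
  this gives the continuity along increasing unions that a capacity must have.\<close>

lemma set_plus_UN_incseq:
  assumes "incseq X" "incseq Y"
  shows "(\<Union>i. X i + Y i) = (\<Union>i. X i) + (\<Union>i. Y i)"
proof (intro equalityI subsetI)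
  fix z assume "z \<in> (\<Union>i. X i) + (\<Union>i. Y i)"
  then obtain i j x y where "x \<in> X i" "y \<in> Y j" "z = x + y"
    by (auto elim!: set_plus_elim)
  then have "x \<in> X (max i j)" "y \<in> Y (max i j)"
    using incseqD[OF assms(1), of i "max i j"] incseqD[OF assms(2), of j "max i j"] by auto
  then show "z \<in> (\<Union>i. X i + Y i)"
    using \<open>z = x + y\<close> by auto
qed (auto elim!: set_plus_elim)

lemma iter_sumset_UN_incseq:
  assumes "incseq X"
  shows "iter_sumset k (\<Union>i. X i) = (\<Union>i. iter_sumset k (X i))"
proof (induction k)
  case (Suc k)
  have "incseq (\<lambda>i. iter_sumset k (X i))"
    using assms by (auto simp: mono_def intro!: iter_sumset_mono)
  with Suc assms show ?case
    by (simp add: sumset_eq_plus set_plus_UN_incseq)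
qed simp

lemma diff_sumset_UN_incseq:
  assumes "incseq X"
  shows "diff_sumset m n (\<Union>i. X i) = (\<Union>i. diff_sumset m n (X i))"
proof -
  have "incseq (\<lambda>i. iter_sumset m (X i))" "incseq (\<lambda>i. uminus ` iter_sumset n (X i))"
    using assms unfolding mono_def by (meson iter_sumset_mono image_mono)+
  then show ?thesis
    by (simp add: diff_sumset_eq_plus iter_sumset_UN_incseq[OF assms] image_UN set_plus_UN_incseq)
qed

section \<open>Compact sets and neighbourhoods of zero in topological groups\<close>

lemma compact_set_plus:
  fixes A B :: "'a::topological_monoid_add set"
  assumes "compact A" "compact B"
  shows "compact (A + B)"
  unfolding set_plus_image case_prod_beta
  by (intro compact_continuous_image continuous_intros compact_Times assms)

lemma compact_uminus_image:
  fixes A :: "'a::topological_group_add set"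
  shows "compact A \<Longrightarrow> compact (uminus ` A)"
  by (intro compact_continuous_image continuous_intros)

lemma compact_iter_sumset:
  fixes B :: "'a::topological_ab_group_add set"
  shows "compact B \<Longrightarrow> compact (iter_sumset k B)"
  by (induction k) (simp_all add: sumset_eq_plus compact_set_plus)

lemma compact_diff_sumset:
  fixes B :: "'a::topological_ab_group_add set"
  shows "compact B \<Longrightarrow> compact (diff_sumset m n B)"
  unfolding diff_sumset_eq_plus
  by (intro compact_set_plus compact_uminus_image compact_iter_sumset)

lemma open_translate:
  fixes U :: "'a::topological_ab_group_add set"
  assumes "open U"
  shows "open ((+) x ` U)"
proof -
  have "(+) x ` U = (\<lambda>y. y - x) -` U"
    by (auto intro!: image_eqI[of _ _ "_ - x"])
  then show ?thesis
    using assms by (auto intro!: open_vimage continuous_intros)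
qed

lemma open_set_plus:
  fixes U :: "'a::topological_ab_group_add set"
  assumes "open U"
  shows "open (A + U)"
proof -
  have "A + U = (\<Union>x\<in>A. (+) x ` U)"
    by (auto simp: set_plus_def)
  then show ?thesis
    using assms by (auto intro!: open_translate)
qed

lemma compact_plus_nhd_subset:
  fixes C U :: "'a::topological_monoid_add set"
  assumes "compact C" "open U" "C \<subseteq> U"
  obtains V where "open V" "0 \<in> V" "C + V \<subseteq> U"
proof -
  let ?W = "(\<lambda>(v, c). c + v) -` U"
  have "open ?W"
    using assms(2) unfolding case_prod_beta by (intro open_vimage continuous_intros)
  moreover have "{0} \<times> C \<subseteq> ?W"
    using assms(3) by auto
  ultimately obtain V where "0 \<in> V" "open V" "V \<times> C \<subseteq> ?W"
    using Elementary_Topology.tube_lemma[OF assms(1)] by blast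
  then show ?thesis
    by (intro that[of V]) (auto simp: set_plus_def)
qed

text \<open>Continuity of addition at the origin, one summand at a time. Symmetry comes from
  intersecting with the negatives; it later turns differences into sums.\<close>

lemma iter_sumset_nhd_subset:
  fixes V :: "'a::topological_ab_group_add set"
  assumes "open V" "0 \<in> V"
  obtains U where "open U" "0 \<in> U" "iter_sumset k U \<subseteq> V" "uminus ` U = U"
proof -
  have "\<exists>U. open U \<and> 0 \<in> U \<and> iter_sumset k U \<subseteq> V"
    using assms
  proof (induction k arbitrary: V)
    case (Suc k)
    have "open ((\<lambda>(x, y). x + y) -` V)"
      using Suc.prems(1) unfolding case_prod_beta by (intro open_vimage continuous_intros)
    moreover have "(0, 0) \<in> (\<lambda>(x, y). x + y) -` V"
      using Suc.prems(2) by simp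
    ultimately obtain N N' where N: "open N" "open N'" "(0, 0) \<in> N \<times> N'"
        "N \<times> N' \<subseteq> (\<lambda>(x, y). x + y) -` V"
      by (elim open_prod_elim)
    obtain U where U: "open U" "0 \<in> U" "iter_sumset k U \<subseteq> N'"
      using Suc.IH[of N'] N by auto
    have "iter_sumset (Suc k) (U \<inter> N) \<subseteq> N + N'"
      using U(3) iter_sumset_mono[of "U \<inter> N" U k]
      by (simp add: sumset_eq_plus) (meson Int_lower1 Int_lower2 order.trans set_plus_mono2)
    also have "\<dots> \<subseteq> V"
      using N(4) by (auto simp: set_plus_def)
    finally show ?case
      using U N by (intro exI[of _ "U \<inter> N"]) auto
  qed auto
  then obtain U where U: "open U" "0 \<in> U" "iter_sumset k U \<subseteq> V"
    by blast
  show ?thesis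
  proof (rule that)
    have "uminus ` U = uminus -` U"
      by (auto simp: image_iff) (metis minus_minus)
    then show "open (U \<inter> uminus ` U)"
      using U(1) by (auto intro!: open_Int open_vimage continuous_intros)
    show "iter_sumset k (U \<inter> uminus ` U) \<subseteq> V"
      using iter_sumset_mono[of "U \<inter> uminus ` U" U k] U(3) by auto
    show "uminus ` (U \<inter> uminus ` U) = U \<inter> uminus ` U"
      by (simp add: image_Int inj_on_def image_image Int_commute)
  qed (use U in \<open>auto simp: image_iff\<close>)
qed

text \<open>Outer continuity at compact sets: replacing \<open>K\<close> by \<open>K + W\<close>
  adds only the summand \<open>diff_sumset m n W\<close>, which for symmetric \<open>W\<close> is an
  \<open>(m + n)\<close>-fold sum and hence small.\<close>

lemma diff_sumset_nhd_subset:
  fixes K U :: "'a::topological_ab_group_add set"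
  assumes "compact K" "open U" "diff_sumset m n K \<subseteq> U"
  obtains V where "open V" "K \<subseteq> V" "diff_sumset m n V \<subseteq> U"
proof -
  obtain N where N: "open N" "0 \<in> N" "diff_sumset m n K + N \<subseteq> U"
    using compact_plus_nhd_subset[OF compact_diff_sumset[OF assms(1)] assms(2,3)] by blast
  obtain W where W: "open W" "0 \<in> W" "iter_sumset (m + n) W \<subseteq> N" "uminus ` W = W"
    using iter_sumset_nhd_subset[OF N(1,2)] by metis
  have "diff_sumset m n W \<subseteq> N"
    using W(3,4) by (simp add: diff_sumset_eq_plus uminus_iter_sumset iter_sumset_add)
  then have "diff_sumset m n (K + W) \<subseteq> U"
    using N(3) unfolding diff_sumset_plus by (meson order.trans set_plus_mono2 order_refl)
  moreover have "K \<subseteq> K + W"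
    using W(2) set_plus_intro[of _ K 0 W] by auto
  ultimately show ?thesis
    using that open_set_plus[OF W(1)] by blast
qed

text \<open>For symmetric \<open>U\<close>, the translate \<open>x + U\<close> of a closure point
  \<open>x\<close> meets \<open>U\<close>, so the closure of \<open>U\<close> lies in
  \<open>U + U\<close>.\<close>

lemma compact_nhd_subset:
  fixes V :: "'a::topological_ab_group_add set"
  assumes "compact (UNIV :: 'a set)" "open V" "0 \<in> V"
  obtains U W where "open U" "0 \<in> U" "U \<subseteq> W" "compact W" "W \<subseteq> V"
proof -
  obtain U where U: "open U" "0 \<in> U" "iter_sumset 2 U \<subseteq> V" "uminus ` U = U"
    using iter_sumset_nhd_subset[OF assms(2,3)] by metis
  have "closure U \<subseteq> V"
  proof
    fix x assume "x \<in> closure U"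
    moreover have "x \<in> (+) x ` U"
      using U(2) by (auto intro!: image_eqI[of _ _ 0])
    ultimately obtain u where u: "u \<in> U" "x + u \<in> U"
      using open_translate[OF U(1), of x] by (auto simp: closure_iff_nhds_not_empty)
    then have "(x + u) + (- u) \<in> U + U"
      using U(4) by (intro set_plus_intro) auto
    then show "x \<in> V"
      using U(3) by (auto simp: numeral_2_eq_2 sumset_eq_plus)
  qed
  then show ?thesis
    using that[of U "closure U"] U assms(1) closure_subset
    by (metis closed_closure compact_Int_closed inf_top_left)
qed

section \<open>Choquet capacitability of K-analytic sets\<close>

text \<open>Choquet's capacitability argument: the compact set is the image of
  \<open>\<Inter>i. \<Union>j\<le>\<sigma> i. K i j\<close>, where the bounds \<open>\<sigma> i\<close> are chosen successively so that
  \<open>\<Phi>\<close> stays above \<open>c\<close>.\<close>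

lemma K_analytic_capacitable:
  fixes \<Phi> :: "'a::topological_space set \<Rightarrow> 'd::complete_linorder"
  assumes B: "K_analytic_via TYPE('b) B"
    and mono: "\<And>X Y. X \<subseteq> Y \<Longrightarrow> \<Phi> X \<le> \<Phi> Y"
    and cont: "\<And>X. incseq X \<Longrightarrow> \<Phi> (\<Union>i. X i) = (SUP i. \<Phi> (X i))"
    and c: "c < \<Phi> B"
  obtains K where "compact K" "K \<subseteq> B" "\<And>V. open V \<Longrightarrow> K \<subseteq> V \<Longrightarrow> c < \<Phi> V"
proof -
  obtain Y :: "'b topology" and S f K where Y: "compact_space Y" "Hausdorff_space Y"
    and K: "\<And>i j. compactin Y (K i j)" and S: "S = (\<Inter>i. \<Union>j::nat. K (i::nat) j)"
    and f: "continuous_map (subtopology Y S) euclidean f" "f ` S = B"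
    using B unfolding K_analytic_via_def K_sigma_delta_in_def by blast
  \<comment> \<open>\<open>R k\<close> is the part of \<open>S\<close> obeying the first
    \<open>k\<close> bounds; the clause for \<open>k = 0\<close> fixes the start of the dependent
    choice.\<close>
  have "\<exists>R. \<forall>k. (R k \<subseteq> S \<and> c < \<Phi> (f ` R k) \<and> (k = 0 \<longrightarrow> R k = S)) \<and>
      (\<exists>N. R (Suc k) = R k \<inter> (\<Union>j\<le>N. K k j))"
  proof (rule dependent_nat_choice)
    show "\<exists>R. R \<subseteq> S \<and> c < \<Phi> (f ` R) \<and> ((0::nat) = 0 \<longrightarrow> R = S)"
      using c f(2) by auto
  next
    fix R :: "'b set" and k :: nat
    assume R: "R \<subseteq> S \<and> c < \<Phi> (f ` R) \<and> (k = 0 \<longrightarrow> R = S)"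
    define X where "X N = f ` (R \<inter> (\<Union>j\<le>N. K k j))" for N
    have "incseq X"
      unfolding X_def mono_def by (intro allI impI image_mono Int_mono UN_mono) auto
    moreover have "R = (\<Union>N. R \<inter> (\<Union>j\<le>N. K k j))"
    proof -
      have "R \<subseteq> (\<Union>j. K k j)"
        using R unfolding S by blast
      then show ?thesis
        by auto
    qed
    then have "f ` R = (\<Union>N. X N)"
      unfolding X_def by (metis image_UN)
    ultimately have "c < (SUP N. \<Phi> (X N))"
      using R cont by metis
    then obtain N where "c < \<Phi> (X N)"
      by (auto simp: less_SUP_iff)
    then show "\<exists>R'. (R' \<subseteq> S \<and> c < \<Phi> (f ` R') \<and> (Suc k = 0 \<longrightarrow> R' = S)) \<and>
        (\<exists>N. R' = R \<inter> (\<Union>j\<le>N. K k j))"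
      using R unfolding X_def by blast
  qed
  then obtain R \<sigma> where R: "R 0 = S" "\<And>k. c < \<Phi> (f ` R k)"
      "\<And>k. R (Suc k) = R k \<inter> (\<Union>j\<le>\<sigma> k. K k j)"
    by metis
  define L where "L k = (\<Union>j\<le>\<sigma> k. K k j)" for k
  have L: "closedin Y (L k)" for k
    unfolding L_def using K Y(2) by (intro closedin_Union) (auto intro: compactin_imp_closedin)
  \<comment> \<open>The sets \<open>R k\<close> need not be closed, but this intersection is, and
    having one finite union for every index places it inside \<open>S\<close>.\<close>
  define T where "T = (\<Inter>k. L k)"
  have "T \<subseteq> S"
    unfolding T_def S L_def by (intro INF_mono') auto
  have "closedin Y T"
    unfolding T_def using L by (intro closedin_INT) auto
  then have "compactin (subtopology Y S) T"
    using Y(1) \<open>T \<subseteq> S\<close> by (simp add: compactin_subtopology closedin_compact_space)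
  then have "compact (f ` T)"
    using image_compactin[OF _ f(1)] by simp
  moreover have "f ` T \<subseteq> B"
    using \<open>T \<subseteq> S\<close> f(2) by blast
  moreover have "c < \<Phi> V" if V: "open V" "f ` T \<subseteq> V" for V
  proof -
    have "openin (subtopology Y S) {x \<in> topspace (subtopology Y S). f x \<in> V}"
      using f(1) V(1) by (intro openin_continuous_map_preimage[of _ euclidean]) auto
    then obtain W where W: "openin Y W" "{x \<in> topspace (subtopology Y S). f x \<in> V} = W \<inter> S"
      by (auto simp: openin_subtopology)
    have "S \<subseteq> topspace Y"
    proof -
      have "S \<subseteq> (\<Union>j. K 0 j)"
        unfolding S by auto
      also have "\<dots> \<subseteq> topspace Y"
        by (intro UN_least compactin_subset_topspace K)
      finally show ?thesis .
    qed
    then have W': "x \<in> W \<longleftrightarrow> f x \<in> V" if "x \<in> S" for x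
      using that eqset_imp_iff[OF W(2), of x] by (auto simp: topspace_subtopology)
    \<comment> \<open>If these nested closed sets were all nonempty, compactness would give a point
      of \<open>T\<close> outside \<open>W\<close>. So finitely many bounds already force points
      into \<open>W\<close>.\<close>
    define D where "D k = (\<Inter>i\<le>k. L i) - W" for k
    have "\<exists>k. D k = {}"
    proof (rule ccontr)
      assume "\<not> (\<exists>k. D k = {})"
      moreover have "closedin Y (D k)" for k
        unfolding D_def using L W(1) by (intro closedin_diff closedin_INT) auto
      moreover have "decseq D"
        unfolding D_def antimono_def by (intro allI impI Diff_mono INF_superset_mono) auto
      ultimately have "(\<Inter>k. D k) \<noteq> {}"
        using compact_space_imp_nest[OF Y(1), of D] by simp
      then obtain x where "\<And>k. x \<in> D k"
        by blast
      then have "x \<in> T" "x \<notin> W"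
        unfolding D_def T_def by auto
      then show False
        using V(2) W'[of x] \<open>T \<subseteq> S\<close> by auto
    qed
    then obtain k where k: "(\<Inter>i\<le>k. L i) \<subseteq> W"
      unfolding D_def by blast
    have "R j = S \<inter> (\<Inter>i<j. L i)" for j
    proof (induction j)
      case (Suc j)
      then show ?case
        unfolding R(3) L_def[symmetric] lessThan_Suc INT_insert by (simp only: Int_ac)
    qed (simp add: R)
    from this[of "Suc k"] have RS: "R (Suc k) = S \<inter> (\<Inter>i\<le>k. L i)"
      unfolding lessThan_Suc_atMost .
    have "f ` R (Suc k) \<subseteq> V"
    proof (rule image_subsetI)
      fix x assume "x \<in> R (Suc k)"
      then have x: "x \<in> S \<inter> (\<Inter>i\<le>k. L i)"
        using RS by (simp only:)
      show "f x \<in> V"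
        using W'[OF IntD1[OF x]] subsetD[OF k IntD2[OF x]] by (simp only:)
    qed
    then show ?thesis
      by (rule order.strict_trans2[OF R(2) mono])
  qed
  ultimately show ?thesis
    by (rule that)
qed

section \<open>Invariance and regularity of Haar measure\<close>

locale haar_compact_group = finite_measure M
  for M :: "'a::{topological_ab_group_add, t2_space} measure" +
  assumes compact_UNIV: "compact (UNIV :: 'a set)"
    and haar: "haar_prob M"
begin

lemma sets_M: "sets M = sets borel"
  using haar by (simp add: haar_prob_def)

lemma compact_in_sets: "compact K \<Longrightarrow> K \<in> sets M"
  by (simp add: sets_M compact_imp_closed)

lemma open_in_sets: "open U \<Longrightarrow> U \<in> sets M"
  by (simp add: sets_M)

lemma translate_in_sets:
  assumes "E \<in> sets M"
  shows "(+) x ` E \<in> sets M"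
proof -
  have "(+) x ` E = (\<lambda>y. y - x) -` E \<inter> space borel"
    by (auto intro!: image_eqI[of _ _ "_ - x"])
  also have "\<dots> \<in> sets borel"
    using assms by (intro measurable_sets[of _ borel borel] borel_measurable_continuous_onI)
      (auto simp: sets_M intro!: continuous_intros)
  finally show ?thesis
    by (simp add: sets_M)
qed

lemma measure_translate: "E \<in> sets M \<Longrightarrow> measure M ((+) x ` E) = measure M E"
  using haar by (simp add: haar_prob_def measure_def)

lemma outer_regular:
  assumes "E \<in> sets M" "emeasure M E < c"
  obtains U where "open U" "E \<subseteq> U" "emeasure M U < c"
proof -
  have "emeasure M E = (INF U\<in>{U. open U \<and> E \<subseteq> U}. emeasure M U)"
    using haar assms(1) unfolding haar_prob_def by blast
  with assms(2) show ?thesis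
    using that by (auto simp: INF_less_iff)
qed

lemma inner_regular:
  assumes "E \<in> sets M" "c < emeasure M E"
  obtains K where "compact K" "K \<subseteq> E" "c < emeasure M K"
proof -
  have "emeasure M E = (SUP K\<in>{K. compact K \<and> K \<subseteq> E}. emeasure M K)"
    using haar assms(1) unfolding haar_prob_def by blast
  with assms(2) show ?thesis
    using that by (auto simp: less_SUP_iff)
qed

text \<open>Outer regularity gives \<open>U\<close>, the tube lemma gives \<open>V\<close>. This is
  the room for discretising Ruzsa's integral and for thickening \<open>B\<close>.\<close>

lemma compact_plus_open_measure_less:
  assumes "compact C" "measure M C < r"
  obtains U V where "open U" "measure M U < r" "open V" "0 \<in> V" "C + V \<subseteq> U"
proof -
  have "emeasure M C < ennreal r"
    using assms(2) by (simp add: emeasure_eq_measure ennreal_lessI order.strict_trans1[OF measure_nonneg])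
  then obtain U where U: "open U" "C \<subseteq> U" "emeasure M U < ennreal r"
    using outer_regular compact_in_sets[OF assms(1)] by metis
  then have "measure M U < r"
    by (simp add: emeasure_eq_measure ennreal_less_iff)
  then show ?thesis
    using that compact_plus_nhd_subset[OF assms(1) U(1,2)] U(1) by metis
qed

section \<open>Ruzsa's triangle inequality\<close>

text \<open>The integral of \<open>g \<mapsto> \<mu> {s \<in> X + Z. s + g \<in> X + Y}\<close> is \<open>\<mu> (X + Y) * \<mu> (X + Z)\<close>
  and the integrand is at least \<open>\<mu> X\<close> on \<open>Y - Z\<close>. Fubini is not available, since Borel sets
  of the square need not be product measurable; instead \<open>X + Z\<close> is cut into finitely many
  small pieces \<open>E i\<close> near points \<open>t i\<close>.\<close>

lemma ruzsa_triangle: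
  assumes X: "compact X" and Y: "compact Y" and Z: "compact Z"
  shows "measure M X * measure M (Y + uminus ` Z) \<le> measure M (X + Y) * measure M (X + Z)"
proof -
  define P Q D where "P = X + Y" and "Q = X + Z" and "D = Y + uminus ` Z"
  have cpt: "compact P" "compact Q" "compact D"
    unfolding P_def Q_def D_def by (intro compact_set_plus compact_uminus_image X Y Z)+
  \<comment> \<open>Any \<open>r\<close> above \<open>measure M P\<close> leaves room for an open
    \<open>U\<close> containing \<open>P + V\<close>; at the end \<open>r\<close> decreases to
    \<open>measure M P\<close>.\<close>
  have *: "measure M X * measure M D \<le> r * measure M Q" if r: "measure M P < r" for r
  proof -
    obtain U V where UV: "open U" "measure M U < r" "open V" "0 \<in> V" "P + V \<subseteq> U"
      using compact_plus_open_measure_less[OF cpt(1) r] by metis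
    obtain N where N: "open N" "0 \<in> N" "iter_sumset 1 N \<subseteq> V" "uminus ` N = N"
      using iter_sumset_nhd_subset[OF UV(3,4)] by metis
    have "UNIV \<subseteq> (\<Union>t\<in>UNIV. (+) t ` N)"
      using N(2) by (auto intro!: image_eqI[of _ _ 0])
    then obtain T where T: "finite T" "UNIV \<subseteq> (\<Union>t\<in>T. (+) t ` N)"
      using compactE_image[OF compact_UNIV, of UNIV "\<lambda>t. (+) t ` N"] open_translate[OF N(1)]
      by metis
    obtain t :: "nat \<Rightarrow> 'a" and n where t: "T = t ` {i. i < n}"
      using finite_imp_nat_seg_image_inj_on[OF T(1)] by metis
    define F where "F i = (+) (t i) ` N \<inter> Q" for i
    define E where "E = disjointed F"
    have F_sets: "range F \<subseteq> sets M"
      unfolding F_def using N(1) cpt(2)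
      by (intro image_subsetI sets.Int translate_in_sets) (auto intro: open_in_sets compact_in_sets)
    then have E_sets: "E i \<in> sets M" for i
      unfolding E_def using sets.range_disjointed_sets by blast
    have E_sub: "E i \<subseteq> (+) (t i) ` N" for i
      unfolding E_def using disjointed_subset[of F i] unfolding F_def by blast
    have "(\<Union>i<n. E i) = (\<Union>i<n. F i)"
      unfolding E_def using finite_UN_disjointed_eq[of F n] by (simp add: atLeast0LessThan)
    also have "\<dots> = Q"
      unfolding F_def using T(2) t by blast
    finally have E_Un: "(\<Union>i<n. E i) = Q" .
    have disj: "disjoint_family_on E {..<n}"
      unfolding E_def using disjoint_family_disjointed by (rule disjoint_family_on_mono[rotated]) auto
    have sum_E: "(\<Sum>i<n. measure M (E i)) = measure M Q"
      unfolding E_Un[symmetric] using E_sets disj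
      by (subst finite_measure_finite_Union) auto
    \<comment> \<open>If \<open>s\<close> is in \<open>E i\<close> and \<open>s + g\<close> in
      \<open>P\<close>, then \<open>t i + g\<close> is in \<open>U\<close>: an open condition on
      \<open>g\<close> alone, describing a translate of \<open>U\<close>.\<close>
    define H where "H i = (+) (- t i) ` U" for i
    have H_sets: "H i \<in> sets M" for i
      unfolding H_def by (intro translate_in_sets open_in_sets UV)
    have pointwise: "measure M X * indicator D g \<le> (\<Sum>i<n. measure M (E i) * indicator (H i) g)" for g
    proof (cases "g \<in> D")
      case True
      then obtain y z where yz: "y \<in> Y" "z \<in> Z" "g = y - z"
        unfolding D_def by (auto elim!: set_plus_elim)
      define I where "I = {i. i < n \<and> g \<in> H i}"
      \<comment> \<open>Adding \<open>g = y - z\<close> sends \<open>z + X\<close> into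
        \<open>P\<close>, so each piece \<open>E i\<close> with \<open>i < n\<close> that meets
        \<open>z + X\<close> has its index in \<open>I\<close>.\<close>
      have "(+) z ` X \<subseteq> (\<Union>i\<in>I. E i)"
      proof
        fix s assume "s \<in> (+) z ` X"
        then obtain x where x: "x \<in> X" "s = z + x"
          by auto
        then have "s \<in> Q"
          unfolding Q_def using set_plus_intro[of x X z Z] yz by (simp add: add.commute)
        then obtain i where i: "i < n" "s \<in> E i"
          using E_Un by blast
        then obtain u where u: "u \<in> N" "s = t i + u"
          using E_sub by blast
        have "- u \<in> V"
          using u(1) N(3,4) by (auto simp: sumset_def)
        moreover have "x + y \<in> P"
          unfolding P_def using x yz by auto
        ultimately have "(x + y) + (- u) \<in> U"
          using UV(5) by blast
        moreover have "g = - t i + ((x + y) + (- u))"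
          using u(2) x(2) yz(3) by (simp add: algebra_simps) (metis add.commute add.left_commute)
        ultimately have "g \<in> H i"
          unfolding H_def by blast
        then show "s \<in> (\<Union>i\<in>I. E i)"
          using i unfolding I_def by blast
      qed
      then have "measure M ((+) z ` X) \<le> measure M (\<Union>i\<in>I. E i)"
        using E_sets by (intro finite_measure_mono) (auto simp: I_def)
      also have "\<dots> \<le> (\<Sum>i\<in>I. measure M (E i))"
        using E_sets by (intro finite_measure_subadditive_finite) (auto simp: I_def)
      also have "\<dots> = (\<Sum>i<n. measure M (E i) * indicator (H i) g)"
        by (intro sum.mono_neutral_cong_left) (auto simp: I_def indicator_def)
      finally show ?thesis
        using True by (simp add: measure_translate compact_in_sets X)
    qed (auto intro!: sum_nonneg)
    have "measure M X * measure M D = (\<integral>g. measure M X * indicator D g \<partial>M)"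
      by (simp add: compact_in_sets cpt)
    also have "\<dots> \<le> (\<integral>g. (\<Sum>i<n. measure M (E i) * indicator (H i) g) \<partial>M)"
      using pointwise H_sets cpt
      by (intro integral_mono Bochner_Integration.integrable_sum integrable_mult_right
          integrable_real_indicator) (auto simp: compact_in_sets emeasure_eq_measure)
    also have "\<dots> = (\<Sum>i<n. measure M (E i) * measure M (H i))"
      using H_sets by (subst Bochner_Integration.integral_sum)
        (auto intro!: integrable_mult_right integrable_real_indicator simp: emeasure_eq_measure)
    also have "\<dots> = measure M Q * measure M U"
      unfolding H_def measure_translate[OF open_in_sets[OF UV(1)]]
      by (simp add: sum_E flip: sum_distrib_right)
    also have "\<dots> \<le> r * measure M Q"
      using UV(2) by (subst mult.commute) (intro mult_right_mono, auto)
    finally show ?thesis .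
  qed
  \<comment> \<open>The limit in \<open>r\<close> is taken after dividing by
    \<open>measure M Q\<close>; if that is 0, a single \<open>r\<close> suffices.\<close>
  have "measure M X * measure M D \<le> measure M P * measure M Q"
  proof (cases "measure M Q = 0")
    case True
    then show ?thesis
      using *[of "measure M P + 1"] by simp
  next
    case False
    then have Q: "measure M Q > 0"
      by (simp add: zero_less_measure_iff)
    have "measure M X * measure M D / measure M Q \<le> measure M P"
    proof (rule dense_ge)
      fix r assume "measure M P < r"
      from *[OF this] show "measure M X * measure M D / measure M Q \<le> r"
        unfolding pos_divide_le_eq[OF Q] .
    qed
    then show ?thesis
      unfolding pos_divide_le_eq[OF Q] .
  qed
  then show ?thesis
    by (simp add: P_def Q_def D_def)
qed

section \<open>Petridis' induction and Pluennecke's inequality\<close>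

text \<open>Each new point \<open>c\<close> costs an error \<open>e\<close>, as \<open>X\<close>
  only almost minimises the ratio. The new part of \<open>X + B + {c}\<close> avoids
  \<open>Z + B + {c}\<close>, where \<open>Z\<close> consists of the points whose contribution is
  already covered, and \<open>min\<close> bounds \<open>Z + B\<close> from below.\<close>

lemma petridis_step:
  assumes X: "compact X" and B: "compact B" and C: "finite C" and "0 \<le> K"
    and min: "\<And>Z. compact Z \<Longrightarrow> Z \<subseteq> X \<Longrightarrow> K * measure M Z \<le> measure M (Z + B)"
    and e: "measure M (X + B) \<le> K * measure M X + e"
  shows "measure M (X + B + C) \<le> K * measure M (X + C) + e * card C"
  using C
proof (induction C rule: finite_induct)
  case (insert c C)
  have C: "compact C"
    using insert.hyps by (simp add: finite_imp_compact)
  define P where "P = X + B + C"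
  have P: "compact P"
    unfolding P_def by (intro compact_set_plus X B C)
  define Z where "Z = X \<inter> (\<Inter>b\<in>B. (\<lambda>x. x + b + c) -` P)"
  have Z: "compact Z"
    unfolding Z_def using X P
    by (intro compact_Int_closed closed_INT ballI closed_vimage continuous_intros compact_imp_closed)
  \<comment> \<open>A coincidence \<open>x + c = x' + c'\<close> gives
    \<open>x + b + c = x' + b + c'\<close>, so these points belong to \<open>Z\<close>.\<close>
  define W where "W = X \<inter> (\<lambda>x. x + c) -` (X + C)"
  have W: "compact W"
    unfolding W_def using X C
    by (intro compact_Int_closed closed_vimage continuous_intros compact_imp_closed compact_set_plus)
  have "W \<subseteq> Z"
  proof
    fix x assume "x \<in> W"
    then obtain x' c' where x: "x \<in> X" "x + c = x' + c'" "x' \<in> X" "c' \<in> C"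
      unfolding W_def by (auto elim!: set_plus_elim)
    have "x + b + c \<in> P" if "b \<in> B" for b
    proof -
      have "x + b + c = x' + b + c'"
        using x(2) by (metis add.commute add.left_commute)
      then show ?thesis
        unfolding P_def using x that by (simp only:) (intro set_plus_intro)
    qed
    then show "x \<in> Z"
      unfolding Z_def using x(1) by auto
  qed
  have sets: "P \<in> sets M" "X + B \<in> sets M" "Z + B \<in> sets M" "X + C \<in> sets M"
      "X \<in> sets M" "W \<in> sets M" "Z \<in> sets M"
    by (intro compact_in_sets compact_set_plus X B C Z W P)+
  have "X + B + insert c C \<subseteq> P \<union> (+) c ` ((X + B) - (Z + B))"
  proof
    fix s assume s: "s \<in> X + B + insert c C"
    show "s \<in> P \<union> (+) c ` ((X + B) - (Z + B))"
    proof (cases "s \<in> P")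
      case False
      then obtain q where q: "q \<in> X + B" "s = c + q"
        using s unfolding P_def by (auto simp: set_plus_insert)
      have "q \<notin> Z + B"
      proof
        assume "q \<in> Z + B"
        then obtain z b where "z \<in> Z" "b \<in> B" "q = z + b"
          by (elim set_plus_elim)
        then have "q + c \<in> P"
          unfolding Z_def by auto
        then show False
          using False q(2) by (simp add: add.commute)
      qed
      then show ?thesis
        using q by blast
    qed simp
  qed
  then have "measure M (X + B + insert c C) \<le> measure M (P \<union> (+) c ` ((X + B) - (Z + B)))"
    using sets by (intro finite_measure_mono sets.Un translate_in_sets sets.Diff) auto
  also have "\<dots> \<le> measure M P + measure M ((+) c ` ((X + B) - (Z + B)))"
    using sets by (intro measure_Un_le translate_in_sets sets.Diff)
  also have "measure M ((+) c ` ((X + B) - (Z + B))) = measure M (X + B) - measure M (Z + B)"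
    using sets by (simp add: measure_translate sets.Diff)
      (intro finite_measure_Diff set_plus_mono2, auto simp: Z_def)
  also have "measure M P + (measure M (X + B) - measure M (Z + B))
      \<le> (K * measure M (X + C) + e * card C) + (K * measure M X + e - K * measure M W)"
  proof -
    have "K * measure M W \<le> K * measure M Z"
      using \<open>W \<subseteq> Z\<close> \<open>0 \<le> K\<close> sets by (intro mult_left_mono finite_measure_mono)
    also have "\<dots> \<le> measure M (Z + B)"
      using Z by (intro min) (auto simp: Z_def)
    finally show ?thesis
      using insert.IH e unfolding P_def by linarith
  qed
  also have "\<dots> = K * (measure M (X + C) + (measure M X - measure M W)) + e * card (insert c C)"
    using insert.hyps by (simp add: algebra_simps)
  \<comment> \<open>Here the gain is exact, since \<open>X + C\<close> and the translate of
    \<open>X - W\<close> are disjoint; the bound thus regains the shape of the induction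
    hypothesis.\<close>
  also have "measure M (X + C) + (measure M X - measure M W) = measure M (X + insert c C)"
  proof -
    have "X + insert c C = (X + C) \<union> (+) c ` (X - W)"
      unfolding W_def set_plus_insert by (auto simp: add.commute)
    moreover have "(X + C) \<inter> (+) c ` (X - W) = {}"
      unfolding W_def by (auto simp: add.commute)
    ultimately have "measure M (X + insert c C) = measure M (X + C) + measure M ((+) c ` (X - W))"
      using sets by (simp add: finite_measure_Union translate_in_sets sets.Diff)
    also have "measure M ((+) c ` (X - W)) = measure M X - measure M W"
      using sets by (simp add: measure_translate sets.Diff)
        (intro finite_measure_Diff, auto simp: W_def)
    finally show ?thesis
      by simp
  qed
  finally show ?case .
qed simp

text \<open>An almost minimiser \<open>X\<close> of \<open>\<mu> (X + B') / \<mu> X\<close> is used, where \<open>B' = B + W\<close> is a slight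
  compact thickening of \<open>B\<close>; the multiples of \<open>B\<close> are then replaced by those of a finite net
  \<open>C\<close>, whose size is known before the quality of \<open>X\<close> has to be fixed.\<close>

lemma pluennecke_compact:
  assumes A: "compact A" and B: "compact B" "B \<noteq> {}"
    and less: "measure M (A + B) < \<alpha> * measure M A"
  obtains X where "compact X" "X \<subseteq> A" "0 < measure M X"
    "\<And>j. j \<le> h \<Longrightarrow> measure M (X + iter_sumset j B) \<le> \<alpha> ^ j * measure M X"
proof -
  \<comment> \<open>The strict inequality survives a small enlargement \<open>V\<close>, so the
    thickened \<open>B'\<close> still has ratio below \<open>\<alpha>\<close>.\<close>
  obtain U V where UV: "open U" "measure M U < \<alpha> * measure M A" "open V" "0 \<in> V" "A + B + V \<subseteq> U"
    using compact_plus_open_measure_less[OF compact_set_plus[OF A B(1)] less] by metis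
  obtain V' W where W: "open V'" "0 \<in> V'" "V' \<subseteq> W" "compact W" "W \<subseteq> V"
    using compact_nhd_subset[OF compact_UNIV UV(3,4)] by metis
  \<comment> \<open>Up to \<open>h\<close> errors from the net must add up inside
    \<open>W\<close>.\<close>
  obtain N where N: "open N" "0 \<in> N" "iter_sumset h N \<subseteq> V'" "uminus ` N = N"
    using iter_sumset_nhd_subset[OF W(1,2)] by metis
  have "B \<subseteq> (\<Union>c\<in>B. (+) c ` N)"
    using N(2) by (intro subsetI UN_I image_eqI[of _ _ 0]) auto
  then obtain C where C: "C \<subseteq> B" "finite C" "B \<subseteq> (\<Union>c\<in>C. (+) c ` N)"
    using compactE_image[OF B(1), of B "\<lambda>c. (+) c ` N"] open_translate[OF N(1)] by metis
  moreover have "(\<Union>c\<in>C. (+) c ` N) = C + N"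
    by (auto simp: set_plus_def)
  ultimately have BCN: "B \<subseteq> C + N"
    by simp
  define B' where "B' = B + W"
  have B': "compact B'"
    unfolding B'_def by (intro compact_set_plus B W)
  have A_pos: "measure M A > 0"
    using less order.strict_trans1[OF measure_nonneg less]
    by (metis mult_zero_right order.irrefl zero_less_measure_iff)
  have "A + B' \<subseteq> A + B + V"
    unfolding B'_def add.assoc[symmetric] using W(5) by (intro set_plus_mono2) auto
  then have "measure M (A + B') \<le> measure M U"
    using UV(1,5) by (intro finite_measure_mono open_in_sets) auto
  then have AB': "measure M (A + B') / measure M A < \<alpha>"
    using UV(2) A_pos by (simp add: divide_less_eq)
  define \<X> where "\<X> = {X. compact X \<and> X \<subseteq> A \<and> 0 < measure M X}"
  define q where "q X = measure M (X + B') / measure M X" for X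
  define K where "K = (INF X\<in>\<X>. q X)"
  have "A \<in> \<X>"
    unfolding \<X>_def using A A_pos by simp
  have bdd: "bdd_below (q ` \<X>)"
    unfolding q_def by (intro bdd_belowI2[of _ 0]) auto
  have K_le: "K \<le> q X" if "X \<in> \<X>" for X
    unfolding K_def using bdd that by (rule cINF_lower)
  have "K < \<alpha>"
    using K_le[OF \<open>A \<in> \<X>\<close>] AB' unfolding q_def by linarith
  have "0 \<le> K"
    unfolding K_def using \<open>A \<in> \<X>\<close> by (intro cINF_greatest) (auto simp: q_def)
  \<comment> \<open>\<open>C\<close> is fixed before \<open>X\<close>, so \<open>n\<close> bounds
    every \<open>card (iter_sumset j C)\<close> in advance and the total Petridis error is at most
    \<open>(\<alpha> - K) * measure M X\<close>.\<close>
  define n where "n = (\<Sum>j\<le>h. card (iter_sumset j C))"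
  define \<epsilon> where "\<epsilon> = (\<alpha> - K) / (n + 1)"
  have "\<epsilon> > 0"
    unfolding \<epsilon>_def using \<open>K < \<alpha>\<close> by simp
  have "(INF X\<in>\<X>. q X) < K + \<epsilon>"
    using \<open>\<epsilon> > 0\<close> by (simp add: K_def)
  then obtain X where X: "X \<in> \<X>" "q X < K + \<epsilon>"
    using bdd \<open>A \<in> \<X>\<close> by (subst (asm) cINF_less_iff) auto
  then have X': "compact X" "X \<subseteq> A" "0 < measure M X"
    unfolding \<X>_def by auto
  have X_le: "measure M (X + B') \<le> K * measure M X + \<epsilon> * measure M X"
    using X(2) X'(3) unfolding q_def by (simp add: divide_less_eq algebra_simps)
  have min: "K * measure M Z \<le> measure M (Z + B')" if "compact Z" "Z \<subseteq> X" for Z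
  proof (cases "measure M Z = 0")
    case False
    then have "measure M Z > 0"
      by (simp add: zero_less_measure_iff)
    then show ?thesis
      using K_le[of Z] that X'(2) by (simp add: q_def \<X>_def le_divide_eq)
  qed simp
  \<comment> \<open>The \<open>W\<close> in \<open>B'\<close> absorbs the error of replacing
    \<open>iter_sumset j B\<close> by the finite \<open>iter_sumset j C\<close>, to which Petridis
    applies; \<open>C \<subseteq> B\<close> leads back to \<open>B\<close>.\<close>
  have step: "measure M (X + iter_sumset (Suc j) B) \<le> \<alpha> * measure M (X + iter_sumset j B)"
    if "j \<le> h" for j
  proof -
    have jB: "compact (X + iter_sumset j B)"
      by (intro compact_set_plus X' compact_iter_sumset B)
    have "iter_sumset j N \<subseteq> W"
      using iter_sumset_le_mono[OF N(2) that] N(3) W(3) by blast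
    then have "iter_sumset j B \<subseteq> iter_sumset j C + W"
      using iter_sumset_mono[OF BCN, of j] unfolding iter_sumset_plus
      by (meson order.trans order_refl set_plus_mono2)
    then have "X + iter_sumset (Suc j) B \<subseteq> X + (B + (iter_sumset j C + W))"
      by (simp add: sumset_eq_plus set_plus_mono2)
    also have "\<dots> = X + B' + iter_sumset j C"
      by (simp add: B'_def ac_simps)
    finally have "measure M (X + iter_sumset (Suc j) B) \<le> measure M (X + B' + iter_sumset j C)"
      by (intro finite_measure_mono compact_in_sets compact_set_plus X' B' finite_imp_compact
          finite_iter_sumset C)
    also have "\<dots> \<le> K * measure M (X + iter_sumset j C) + \<epsilon> * measure M X * card (iter_sumset j C)"
      using petridis_step[OF X'(1) B' finite_iter_sumset[OF C(2)] \<open>0 \<le> K\<close> min X_le] .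
    also have "\<dots> \<le> K * measure M (X + iter_sumset j B) + (\<alpha> - K) * measure M (X + iter_sumset j B)"
    proof (intro add_mono mult_left_mono \<open>0 \<le> K\<close>)
      show "measure M (X + iter_sumset j C) \<le> measure M (X + iter_sumset j B)"
        using C(1) by (intro finite_measure_mono compact_in_sets jB set_plus_mono2 iter_sumset_mono) auto
      have "card (iter_sumset j C) \<le> n"
        unfolding n_def using that by (intro member_le_sum) auto
      then have "\<epsilon> * card (iter_sumset j C) \<le> \<epsilon> * (n + 1)"
        using \<open>\<epsilon> > 0\<close> by (intro mult_left_mono) auto
      also have "\<dots> = \<alpha> - K"
        unfolding \<epsilon>_def by (simp add: field_simps)
      finally have "\<epsilon> * card (iter_sumset j C) * measure M X \<le> (\<alpha> - K) * measure M (X + iter_sumset j B)"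
      proof (rule mult_mono)
        obtain b where b: "b \<in> iter_sumset j B"
          using iter_sumset_nonempty[OF B(2)] by blast
        then have "(+) b ` X \<subseteq> X + iter_sumset j B"
          by (auto simp: set_plus_def add.commute)
        then have "measure M ((+) b ` X) \<le> measure M (X + iter_sumset j B)"
          by (intro finite_measure_mono compact_in_sets jB)
        then show "measure M X \<le> measure M (X + iter_sumset j B)"
          by (simp add: measure_translate compact_in_sets X')
      qed (use \<open>K < \<alpha>\<close> in auto)
      then show "\<epsilon> * measure M X * card (iter_sumset j C) \<le> (\<alpha> - K) * measure M (X + iter_sumset j B)"
        by (simp add: ac_simps)
    qed
    finally show ?thesis
      by (simp add: algebra_simps)
  qed
  have "measure M (X + iter_sumset j B) \<le> \<alpha> ^ j * measure M X" if "j \<le> h" for j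
    using that
  proof (induction j)
    case (Suc j)
    have "measure M (X + iter_sumset (Suc j) B) \<le> \<alpha> * measure M (X + iter_sumset j B)"
      using Suc.prems by (intro step) auto
    also have "\<dots> \<le> \<alpha> * (\<alpha> ^ j * measure M X)"
      using Suc \<open>0 \<le> K\<close> \<open>K < \<alpha>\<close> by (intro mult_left_mono) auto
    finally show ?case
      by (simp add: ac_simps)
  qed simp
  with X' show ?thesis
    by (rule that)
qed

section \<open>Difference sets: the compact case and inner approximation\<close>

text \<open>Ruzsa's inequality needs both growth bounds for the same \<open>X\<close>, hence
  \<open>h = max m n\<close>; one factor \<open>measure M X\<close> then cancels.\<close>

lemma measure_diff_sumset_compact_le:
  assumes A: "compact A" and B: "compact B" "B \<noteq> {}"
    and less: "measure M (A + B) < \<alpha> * measure M A"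
  shows "measure M (diff_sumset m n B) \<le> \<alpha> ^ (m + n) * measure M A"
proof -
  obtain X where X: "compact X" "X \<subseteq> A" "0 < measure M X"
    and le: "\<And>j. j \<le> max m n \<Longrightarrow> measure M (X + iter_sumset j B) \<le> \<alpha> ^ j * measure M X"
    using pluennecke_compact[OF assms, of "max m n"] by metis
  have "0 \<le> \<alpha>"
    using order.strict_trans1[OF measure_nonneg less]
    by (metis measure_nonneg less_le_not_le linorder_linear mult_nonpos_nonneg)
  have "measure M X * measure M (diff_sumset m n B)
      \<le> measure M (X + iter_sumset m B) * measure M (X + iter_sumset n B)"
    unfolding diff_sumset_eq_plus by (intro ruzsa_triangle X compact_iter_sumset B)
  also have "\<dots> \<le> (\<alpha> ^ m * measure M X) * (\<alpha> ^ n * measure M X)"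
    using \<open>0 \<le> \<alpha>\<close> by (intro mult_mono le) auto
  also have "\<dots> = measure M X * (\<alpha> ^ (m + n) * measure M X)"
    by (simp add: power_add)
  finally have "measure M (diff_sumset m n B) \<le> \<alpha> ^ (m + n) * measure M X"
    using X(3) by simp
  also have "\<dots> \<le> \<alpha> ^ (m + n) * measure M A"
    using \<open>0 \<le> \<alpha>\<close> X(2) by (intro mult_left_mono finite_measure_mono compact_in_sets A) auto
  finally show ?thesis .
qed

text \<open>Outer measure is continuous along increasing unions of arbitrary sets, so it yields a
  capacity. Capacitability gives a bound on open neighbourhoods of \<open>K\<close>; outer
  regularity carries it to \<open>K\<close> itself.\<close>

lemma diff_sumset_inner_regular:
  assumes "K_analytic_via TYPE('b) B" "c < outer_measure_of M (diff_sumset m n B)"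
  obtains K where "compact K" "K \<subseteq> B" "c < emeasure M (diff_sumset m n K)"
proof -
  define \<Phi> where "\<Phi> X = outer_measure_of M (diff_sumset m n X)" for X
  have "space M = UNIV"
    using sets_eq_imp_space_eq[OF sets_M] by simp
  \<comment> \<open>Passing from neighbourhoods to \<open>K\<close> gives only a weak inequality;
    the intermediate \<open>c'\<close> restores strictness.\<close>
  obtain c' where c': "c < c'" "c' < \<Phi> B"
    using dense assms(2) unfolding \<Phi>_def by blast
  have mono: "\<Phi> X \<le> \<Phi> Y" if "X \<subseteq> Y" for X Y
    unfolding \<Phi>_def by (intro outer_measure_of_mono diff_sumset_mono that)
  have cont: "\<Phi> (\<Union>i. X i) = (SUP i. \<Phi> (X i))" if "incseq X" for X
  proof -
    have "incseq (\<lambda>i. diff_sumset m n (X i))"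
      using that unfolding mono_def by (meson diff_sumset_mono)
    then show ?thesis
      using SUP_outer_measure_of_incseq[of "\<lambda>i. diff_sumset m n (X i)" M] \<open>space M = UNIV\<close>
      by (simp add: \<Phi>_def diff_sumset_UN_incseq[OF that])
  qed
  obtain K where K: "compact K" "K \<subseteq> B" "\<And>V. open V \<Longrightarrow> K \<subseteq> V \<Longrightarrow> c' < \<Phi> V"
    using K_analytic_capacitable[OF assms(1) mono cont c'(2)] by metis
  have "c' \<le> emeasure M (diff_sumset m n K)"
  proof (rule ccontr)
    assume "\<not> c' \<le> emeasure M (diff_sumset m n K)"
    then obtain U where U: "open U" "diff_sumset m n K \<subseteq> U" "emeasure M U < c'"
      using outer_regular[OF compact_in_sets[OF compact_diff_sumset[OF K(1)]]] by (metis not_le)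
    obtain V where V: "open V" "K \<subseteq> V" "diff_sumset m n V \<subseteq> U"
      using diff_sumset_nhd_subset[OF K(1) U(1,2)] by metis
    have "\<Phi> V \<le> emeasure M U"
      using outer_measure_of_mono[OF V(3), of M] U(1) by (simp add: \<Phi>_def open_in_sets)
    then show False
      using K(3)[OF V(1,2)] U(3) by order
  qed
  then show ?thesis
    using that K(1,2) c'(1) by (meson order.strict_trans2)
qed

end

section \<open>From compact to K-analytic sets in the completion\<close>

text \<open>For non-measurable \<open>D\<close> the left side is 0 by convention. Hence a bound on
  the outer measure suffices in the end.\<close>

lemma emeasure_completion_le_outer_measure_of:
  "emeasure (completion M) D \<le> outer_measure_of M D"
  unfolding outer_measure_of_def
proof (rule INF_greatest)
  fix E assume "E \<in> {E \<in> sets M. D \<subseteq> E}"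
  then show "emeasure (completion M) D \<le> emeasure M E"
    using emeasure_mono[of D E "completion M"] by simp
qed

theorem theorem1p3:
  fixes M :: "'a::{topological_ab_group_add, t2_space} measure"
    and A B :: "'a set" and \<alpha> :: real and m n :: nat
  assumes "compact (UNIV :: 'a set)"
    and "haar_prob M"
    and "K_analytic_via TYPE('b) A"
    and "K_analytic_via TYPE('c) B"
    and "0 < measure (completion M) (sumset A B)"
    and "measure (completion M) (sumset A B) \<le> \<alpha> * measure (completion M) A"
  shows "measure (completion M) (diff_sumset m n B) \<le> \<alpha> ^ (m + n) * measure (completion M) A"
proof -
  have "emeasure M (space M) = 1"
    using assms(2) unfolding haar_prob_def by blast
  then interpret haar_compact_group M
    using assms(1,2) by (intro haar_compact_group.intro haar_compact_group_axioms.intro finite_measureI) simp_all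
  interpret completion: finite_measure "completion M"
    by (intro finite_measureI) (simp add: emeasure_eq_measure)
  define a where "a = measure (completion M) A"
  have "0 < \<alpha> * a"
    using assms(5,6) by (simp add: a_def)
  then have a: "0 < a" and \<alpha>: "0 < \<alpha>"
    using measure_nonneg[of "completion M" A] by (auto simp: a_def zero_less_mult_iff)
  have A: "A \<in> sets (completion M)" and AB: "A + B \<in> sets (completion M)"
    using a assms(5) measure_notin_sets unfolding a_def sumset_eq_plus by fastforce+
  \<comment> \<open>An empty \<open>B\<close> would make \<open>A + B\<close> null. Adjoining
    \<open>b\<close> later makes the compact subset of \<open>B\<close> nonempty.\<close>
  obtain b where b: "b \<in> B"
    using assms(5) by (cases "B = {}") (auto simp: sumset_eq_plus)
  have compact_le: "measure M (diff_sumset m n K) \<le> \<alpha> ^ (m + n) * a"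
    if K: "compact K" "K \<subseteq> B" "K \<noteq> {}" for K
  proof -
    \<comment> \<open>The compact case asks for a strict inequality, which \<open>\<beta>\<close>
      above \<open>\<alpha>\<close> provides; then \<open>\<beta>\<close> decreases to
      \<open>\<alpha>\<close>.\<close>
    have le: "measure M (diff_sumset m n K) \<le> \<beta> ^ (m + n) * a" if "\<alpha> < \<beta>" for \<beta>
    proof -
      have "\<alpha> * a / \<beta> < a"
        using that a \<alpha> by (simp add: divide_less_eq)
      \<comment> \<open>The main part of \<open>A\<close> is a Borel set of the same measure, so
        inner regularity applies. The level is chosen to give
        \<open>\<alpha> * a < \<beta> * measure M A'\<close>.\<close>
      then have "ennreal (\<alpha> * a / \<beta>) < emeasure M (main_part M A)"
        using A a by (simp add: a_def ennreal_lessI completion.emeasure_eq_measure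
            flip: emeasure_completion)
      then obtain A' where A': "compact A'" "A' \<subseteq> main_part M A" "ennreal (\<alpha> * a / \<beta>) < emeasure M A'"
        using inner_regular[OF main_part_sets[OF A]] by metis
      have "A' \<subseteq> A"
        using A'(2) main_part_null_part_Un[OF A] by blast
      have "measure M (A' + K) = measure (completion M) (A' + K)"
        by (simp add: compact_in_sets compact_set_plus A' K)
      also have "\<dots> \<le> measure (completion M) (A + B)"
        using AB \<open>A' \<subseteq> A\<close> K(2) by (intro completion.finite_measure_mono set_plus_mono2)
      also have "\<dots> \<le> \<alpha> * a"
        using assms(6) by (simp add: a_def sumset_eq_plus)
      also have "\<dots> < \<beta> * measure M A'"
        using A'(3) that a \<alpha> by (simp add: emeasure_eq_measure ennreal_less_iff divide_less_eq ac_simps)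
      finally have "measure M (diff_sumset m n K) \<le> \<beta> ^ (m + n) * measure M A'"
        by (intro measure_diff_sumset_compact_le A'(1) K)
      also have "measure M A' = measure (completion M) A'"
        by (simp add: compact_in_sets A')
      also have "\<beta> ^ (m + n) * measure (completion M) A' \<le> \<beta> ^ (m + n) * a"
        unfolding a_def using that \<alpha> \<open>A' \<subseteq> A\<close> A
        by (intro mult_left_mono completion.finite_measure_mono) auto
      finally show ?thesis .
    qed
    have "((\<lambda>\<beta>. \<beta> ^ (m + n) * a) \<longlongrightarrow> \<alpha> ^ (m + n) * a) (at_right \<alpha>)"
      by (intro tendsto_intros)
    then show ?thesis
      by (rule tendsto_lowerbound) (auto intro!: eventually_at_right_less[THEN eventually_mono] le)
  qed
  have "outer_measure_of M (diff_sumset m n B) \<le> ennreal (\<alpha> ^ (m + n) * a)"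
  proof (rule ccontr)
    assume "\<not> ?thesis"
    then obtain K where K: "compact K" "K \<subseteq> B" "ennreal (\<alpha> ^ (m + n) * a) < emeasure M (diff_sumset m n K)"
      using diff_sumset_inner_regular[OF assms(4)] by (metis not_le)
    have K': "compact (insert b K)"
      using K(1) by simp
    note K(3)
    also have "emeasure M (diff_sumset m n K) \<le> emeasure M (diff_sumset m n (insert b K))"
      by (intro emeasure_mono diff_sumset_mono compact_in_sets compact_diff_sumset K') auto
    also have "\<dots> \<le> ennreal (\<alpha> ^ (m + n) * a)"
      using compact_le[OF K'] K(2) b by (simp add: emeasure_eq_measure ennreal_leI)
    finally show False
      by simp
  qed
  with emeasure_completion_le_outer_measure_of
  have "emeasure (completion M) (diff_sumset m n B) \<le> ennreal (\<alpha> ^ (m + n) * a)"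
    by (rule order.trans)
  then show ?thesis
    using a \<alpha> unfolding a_def[symmetric]
    by (simp add: completion.emeasure_eq_measure ennreal_le_iff)
qed

end
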